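(* Let $A\in M_n(\mathbb{R}_+)$ and $1\le k<n$. Then $conv_\otimes\big(\sigma_{max}^k(A)\big)\subseteq W_{\max}^k(A)$.
   Context: $\mathbb{R}_+$ is the set of nonnegative reals, $M_{m\times n}(\mathbb{R}_+)$ the set of $m\times n$ matrices with nonnegative real entries, $M_n(\mathbb{R}_+)=M_{n\times n}(\mathbb{R}_+)$. Max algebra: $a\oplus b=\max\{a,b\}$, $(A\otimes B)_{ij}=\max_l a_{il}b_{lj}$; $A_\otimes^j$ is the $j$th power of $A$ in max algebra; $\|x\|=\max_i|x_i|$; $tr_\otimes(A)=\max_i a_{ii}$. The max $k$-numerical range: $W_{\max}^k(A)=\{tr_\otimes(X^t\otimes A\otimes X): X\in M_{n\times k}(\mathbb{R}_+),\ X^t\otimes X=I_k\}$. The local spectral radius at $x\in\mathbb{R}_+^n$ is $r_x(A)=\limsup_{j\to\infty}\|A_\otimes^j\otimes x\|^{1/j}$. A number $\mu\ge0$ is a geometric max eigenvalue of $A$ if $A\otimes x=\mu x$ for some $x\ge0$, $x\ne0$; the set of these is $\sigma_{max}(A)$. It is known that $\sigma_{max}(A)=\{r_{e_j}(A): j=1,\dots,n\}$, where $e_j$ are the standard basis vectors; the standard vector multiplicity of $\mu\in\sigma_{max}(A)$ is the number of indices $j$ with $\mu=r_{e_j}(A)$. Let $\mu_1,\dots,\mu_n$ be the geometric max eigenvalues listed with standard vector multiplicities (i.e. the list $r_{e_1}(A),\dots,r_{e_n}(A)$). The max $k$-geometric spectrum is $\sigma_{max}^k(A)=\{\max_{1\le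 j\le k}\mu_{i_j}: 1\le i_1<\cdots<i_k\le n\}$. For $M\subseteq\mathbb{R}_+$, the max convex hull is $conv_\otimes(M)=\{\bigoplus_{i=1}^m\alpha_ix_i: m\in\mathbb{N},\ x_i\in M,\ \alpha_i\ge0,\ \bigoplus_{i=1}^m\alpha_i=1\}$. *)

theory Defs
  imports Complex_Main "HOL-Library.Extended_Real" "Jordan_Normal_Form.Matrix"
begin

text \<open>
  Matrices and vectors are those of \<^theory>\<open>Jordan_Normal_Form.Matrix\<close>, so indices start at 0.
  All maxima below are taken with \<^const>\<open>Max\<close>, which is unspecified on the empty set;
  the dimensions involved are always meant to be positive.
\<close>

definition nonneg_mat :: "nat \<Rightarrow> nat \<Rightarrow> real mat set" where
  "nonneg_mat m n = {A \<in> carrier_mat m n. \<forall>i<m. \<forall>j<n. 0 \<le> A $$ (i, j)}"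

definition max_mat_mult :: "real mat \<Rightarrow> real mat \<Rightarrow> real mat" (infixl \<open>\<otimes>\<^sub>m\<close> 70) where
  "A \<otimes>\<^sub>m B = mat (dim_row A) (dim_col B)
     (\<lambda>(i, j). Max ((\<lambda>l. A $$ (i, l) * B $$ (l, j)) ` {..<dim_col A}))"

definition max_mat_vec :: "real mat \<Rightarrow> real vec \<Rightarrow> real vec" (infixr \<open>\<otimes>\<^sub>v\<close> 70) where
  "A \<otimes>\<^sub>v x = vec (dim_row A) (\<lambda>i. Max ((\<lambda>l. A $$ (i, l) * x $ l) ` {..<dim_col A}))"

text \<open>On nonnegative matrices the ordinary identity matrix is also the max-algebraic unit.\<close>

fun max_mat_pow :: "real mat \<Rightarrow> nat \<Rightarrow> real mat" where
  "max_mat_pow A 0 = 1\<^sub>m (dim_row A)"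
| "max_mat_pow A (Suc j) = max_mat_pow A j \<otimes>\<^sub>m A"

definition max_trace :: "real mat \<Rightarrow> real" where
  "max_trace A = Max ((\<lambda>i. A $$ (i, i)) ` {..<dim_row A})"

definition max_norm_vec :: "real vec \<Rightarrow> real" where
  "max_norm_vec x = Max ((\<lambda>i. \<bar>x $ i\<bar>) ` {..<dim_vec x})"

definition max_numerical_range :: "nat \<Rightarrow> real mat \<Rightarrow> real set" where
  "max_numerical_range k A =
     {max_trace (X\<^sup>T \<otimes>\<^sub>m A \<otimes>\<^sub>m X) | X.
        X \<in> nonneg_mat (dim_row A) k \<and> X\<^sup>T \<otimes>\<^sub>m X = 1\<^sub>m k}"

text \<open>
  The limit superior is formed in the extended reals. For a nonnegative square matrix \<open>A\<close> with
  largest entry \<open>c\<close>, the norm of \<open>A\<^sup>j \<otimes> x\<close> is at most \<open>c\<^sup>j\<close> times that of \<open>x\<close>, so the limit superior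
  is finite and the conversion back to the reals loses nothing.
\<close>

definition local_spectral_radius :: "real mat \<Rightarrow> real vec \<Rightarrow> real" where
  "local_spectral_radius A x =
     real_of_ereal (limsup (\<lambda>j. ereal (root j (max_norm_vec (max_mat_pow A j \<otimes>\<^sub>v x)))))"

text \<open>
  The numbers \<open>\<mu>\<close> with \<open>A \<otimes> x = \<mu> x\<close> for some nonnegative nonzero \<open>x\<close> are exactly the local
  spectral radii of \<open>A\<close> at the standard basis vectors, and the standard vector multiplicity of \<open>\<mu>\<close>
  is the number of indices \<open>j\<close> at which it occurs. The list of geometric max eigenvalues with
  these multiplicities is therefore the following one, for \<open>j < n\<close>.
\<close>

definition geom_max_eigenvalue :: "real mat \<Rightarrow> nat \<Rightarrow> real" where
  "geom_max_eigenvalue A j = local_spectral_radius A (unit_vec (dim_row A) j)"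

definition max_geom_spectrum :: "nat \<Rightarrow> real mat \<Rightarrow> real set" where
  "max_geom_spectrum k A =
     {Max ((\<lambda>j. geom_max_eigenvalue A (i j)) ` {..<k}) | i :: nat \<Rightarrow> nat.
        strict_mono_on {..<k} i \<and> i ` {..<k} \<subseteq> {..<dim_row A}}"

text \<open>
  The case \<open>m = 0\<close> is excluded: the empty max-sum is 0 and so cannot satisfy the
  normalisation of the coefficients.
\<close>

definition max_convex_hull :: "real set \<Rightarrow> real set" where
  "max_convex_hull M =
     {Max ((\<lambda>i. \<alpha> i * x i) ` {..<m}) | (m :: nat) (\<alpha> :: nat \<Rightarrow> real) (x :: nat \<Rightarrow> real).
        0 < m \<and> (\<forall>i<m. x i \<in> M) \<and> (\<forall>i<m. 0 \<le> \<alpha> i) \<and> Max (\<alpha> ` {..<m}) = 1}"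

end

theory Submission
  imports Defs
begin

text \<open>
  Both sides are governed by the same interval. Two facts bound the local spectral radius \<open>r\<^sub>j\<close> at
  the unit vector \<open>e\<^sub>j\<close>:
  the diagonal entry of \<open>A\<^sup>t\<close> at \<open>j\<close> is at least \<open>a\<^sub>j\<^sub>j\<^sup>t\<close>, because the closed walk that stays at
  \<open>j\<close> has this weight, and no entry of \<open>A\<^sup>t\<close> exceeds the \<open>t\<close>-th power of the largest entry \<open>M\<close> of
  \<open>A\<close>. Hence \<open>a\<^sub>j\<^sub>j \<le> r\<^sub>j \<le> M\<close> (\<open>geom_max_eigenvalue_bounds\<close>). In a max convex combination
  some coefficient equals 1 and the others are at most 1, so a point \<open>v\<close> of the hull satisfies
  \<open>v \<le> M\<close>, and there is a set \<open>S\<close> of \<open>k\<close> indices with \<open>a\<^sub>s\<^sub>s \<le> v\<close> for all \<open>s \<in> S\<close>.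

  It remains to see that every such \<open>v\<close> is in the numerical range. An admissible \<open>X\<close> has columns
  of max norm 1 with disjoint supports. The unit vectors \<open>e\<^sub>s\<close>, \<open>s \<in> S\<close>, give a trace at most \<open>v\<close>.
  Since \<open>k < n\<close>, there is an index \<open>m\<close> outside \<open>S\<close>, and one column \<open>e\<^sub>l\<close> can be deformed to
  \<open>e\<^sub>l \<oplus> t e\<^sub>m\<close> with \<open>t\<close> running from 0 to 1. By the intermediate value theorem the trace then
  takes the value \<open>v\<close> if \<open>v\<close> is at most some entry with both indices in \<open>{l, m}\<close>
  (\<open>attained_by_deforming_column\<close>). In particular either \<open>v\<close> is attained or \<open>a\<^sub>m\<^sub>m \<le> v\<close>, and in the
  second case \<open>l\<close> may be replaced by \<open>m\<close> in \<open>S\<close>. If the largest entry \<open>a\<^sub>p\<^sub>q = M\<close> is off the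
  diagonal, at most one such exchange arranges that \<open>S\<close> contains exactly one of \<open>p\<close> and \<open>q\<close>, and
  the deformation that joins \<open>p\<close> and \<open>q\<close> in one column attains \<open>v\<close>. If \<open>p = q\<close>, any deformation
  with \<open>p\<close> as \<open>l\<close> or \<open>m\<close> does (\<open>max_numerical_range_contains\<close>).
\<close>

section \<open>Points of the max numerical range\<close>

lemma max_trace_congruence_eqI:
  assumes A: "A \<in> carrier_mat n n" and X: "X \<in> nonneg_mat n k"
    and le: "\<And>c i j. c < k \<Longrightarrow> i < n \<Longrightarrow> j < n \<Longrightarrow> X $$ (i, c) * A $$ (i, j) * X $$ (j, c) \<le> v"
    and c: "c < k" and i: "i < n" and j: "j < n"
    and eq: "X $$ (i, c) * A $$ (i, j) * X $$ (j, c) = v"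
  shows "max_trace (X\<^sup>T \<otimes>\<^sub>m A \<otimes>\<^sub>m X) = v"
proof -
  have dA: "dim_row A = n" "dim_col A = n" and dX: "dim_row X = n" "dim_col X = k"
    and X0: "\<And>i c. i < n \<Longrightarrow> c < k \<Longrightarrow> 0 \<le> X $$ (i, c)"
    using A X by (auto simp: nonneg_mat_def)
  define row where "row d s = Max ((\<lambda>r. X $$ (r, d) * A $$ (r, s)) ` {..<n})" for d s
  define val where "val d = Max ((\<lambda>s. row d s * X $$ (s, d)) ` {..<n})" for d
  have entry: "(X\<^sup>T \<otimes>\<^sub>m A \<otimes>\<^sub>m X) $$ (d, d) = val d" if "d < k" for d
    unfolding val_def row_def using that
    by (auto simp: max_mat_mult_def dA dX intro!: arg_cong[where f = Max] image_cong)
  have upper: "val d \<le> v" if "d < k" for d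
    unfolding val_def
  proof (subst Max_le_iff)
    show "\<forall>a\<in>(\<lambda>s. row d s * X $$ (s, d)) ` {..<n}. a \<le> v"
    proof safe
      fix s assume s: "s < n"
      have "row d s \<in> (\<lambda>r. X $$ (r, d) * A $$ (r, s)) ` {..<n}"
        unfolding row_def by (rule Max_in) (use s in auto)
      then show "row d s * X $$ (s, d) \<le> v"
        using le[OF that _ s] by auto
    qed
  qed (use i in auto)
  have "X $$ (i, c) * A $$ (i, j) \<le> row c j"
    unfolding row_def by (rule Max_ge) (use i in auto)
  then have "v \<le> row c j * X $$ (j, c)"
    using eq X0[OF j c] by (metis mult_right_mono)
  also have "\<dots> \<le> val c"
    unfolding val_def by (rule Max_ge) (use j in auto)
  finally have lower: "v \<le> val c" .
  have "dim_row (X\<^sup>T \<otimes>\<^sub>m A \<otimes>\<^sub>m X) = k"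
    by (simp add: max_mat_mult_def dX)
  then have "max_trace (X\<^sup>T \<otimes>\<^sub>m A \<otimes>\<^sub>m X) = Max (val ` {..<k})"
    unfolding max_trace_def using entry
    by (auto intro!: arg_cong[where f = Max] image_cong)
  also have "\<dots> = v"
    by (rule Max_eqI) (use upper lower c in \<open>auto intro: antisym\<close>)
  finally show ?thesis .
qed

text \<open>
  In max algebra the condition \<open>X\<^sup>T \<otimes> X = I\<close> on a nonnegative matrix says that its columns have
  pairwise disjoint supports and largest entry 1. The second requirement is split here into the
  bound and an index \<open>h c\<close> at which column \<open>c\<close> attains it.
\<close>

lemma max_orthonormal_columnsI:
  assumes X: "X \<in> nonneg_mat n k"
    and le1: "\<And>i c. i < n \<Longrightarrow> c < k \<Longrightarrow> X $$ (i, c) \<le> 1"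
    and h: "\<And>c. c < k \<Longrightarrow> h c < n \<and> X $$ (h c, c) = 1"
    and disj: "\<And>i c d. i < n \<Longrightarrow> c < k \<Longrightarrow> d < k \<Longrightarrow> c \<noteq> d \<Longrightarrow> X $$ (i, c) = 0 \<or> X $$ (i, d) = 0"
  shows "X\<^sup>T \<otimes>\<^sub>m X = 1\<^sub>m k"
proof (rule eq_matI)
  have dX: "dim_row X = n" "dim_col X = k"
    and X0: "\<And>i c. i < n \<Longrightarrow> c < k \<Longrightarrow> 0 \<le> X $$ (i, c)"
    using X by (auto simp: nonneg_mat_def)
  show "dim_row (X\<^sup>T \<otimes>\<^sub>m X) = dim_row (1\<^sub>m k)" "dim_col (X\<^sup>T \<otimes>\<^sub>m X) = dim_col (1\<^sub>m k)"
    by (simp_all add: max_mat_mult_def dX)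
  fix c d assume "c < dim_row (1\<^sub>m k)" "d < dim_col (1\<^sub>m k)"
  then have c: "c < k" and d: "d < k" by auto
  have "(X\<^sup>T \<otimes>\<^sub>m X) $$ (c, d) = Max ((\<lambda>i. X $$ (i, c) * X $$ (i, d)) ` {..<n})"
    using c d by (auto simp: max_mat_mult_def dX intro!: arg_cong[where f = Max] image_cong)
  also have "\<dots> = (if c = d then 1 else 0)"
  proof (rule Max_eqI)
    fix y assume "y \<in> (\<lambda>i. X $$ (i, c) * X $$ (i, d)) ` {..<n}"
    then obtain i where i: "i < n" "y = X $$ (i, c) * X $$ (i, d)" by auto
    show "y \<le> (if c = d then 1 else 0)"
      using i le1[OF i(1) c] X0[OF i(1) c] disj[OF i(1) c d] by (auto intro: mult_le_one)
  next
    have "X $$ (h c, c) * X $$ (h c, d) = (if c = d then 1 else 0)"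
      using h[OF c] disj[of "h c" c d] c d by auto
    then show "(if c = d then 1 else 0) \<in> (\<lambda>i. X $$ (i, c) * X $$ (i, d)) ` {..<n}"
      using h[OF c] by (intro image_eqI[of _ _ "h c"]) auto
  qed simp
  finally show "(X\<^sup>T \<otimes>\<^sub>m X) $$ (c, d) = 1\<^sub>m k $$ (c, d)"
    using c d by simp
qed

text \<open>
  The deformed column \<open>e\<^sub>l \<oplus> t e\<^sub>m\<close> contributes \<open>g t\<close>, the maximum of \<open>a\<^sub>l\<^sub>l\<close>, \<open>t a\<^sub>l\<^sub>m\<close>, \<open>t a\<^sub>m\<^sub>l\<close> and
  \<open>t\<^sup>2 a\<^sub>m\<^sub>m\<close>, to the trace. It is continuous in \<open>t\<close>, with \<open>g 0 = a\<^sub>l\<^sub>l \<le> v\<close>, and \<open>g 1\<close> is the largest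
  entry with both indices in \<open>{l, m}\<close>, so some \<open>t\<close> gives \<open>g t = v\<close>. The other columns contribute
  diagonal entries with index in \<open>S\<close>, which are at most \<open>v\<close> and so do not change the maximum.
\<close>

lemma attained_by_deforming_column:
  assumes A: "A \<in> nonneg_mat n n"
    and S: "S \<subseteq> {..<n}" "card S = k" and diag: "\<And>s. s \<in> S \<Longrightarrow> A $$ (s, s) \<le> v"
    and l: "l \<in> S" and m: "m < n" "m \<notin> S"
    and v: "\<exists>i\<in>{l, m}. \<exists>j\<in>{l, m}. v \<le> A $$ (i, j)"
  shows "v \<in> max_numerical_range k A"
proof -
  have cA: "A \<in> carrier_mat n n" and dA: "dim_row A = n"
    using A by (auto simp: nonneg_mat_def)
  have ln: "l < n" using l S by auto
  have v0: "0 \<le> v"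
    using A ln diag[OF l] by (force simp: nonneg_mat_def)
  define g where
    "g t = max (max (A $$ (l, l)) (t^2 * A $$ (m, m))) (max (t * A $$ (l, m)) (t * A $$ (m, l)))"
    for t :: real
  have "continuous_on {0..1} g"
    unfolding g_def by (intro continuous_intros)
  moreover have "g 0 \<le> v"
    using v0 diag[OF l] by (simp add: g_def)
  moreover have "v \<le> g 1"
    using v by (auto simp: g_def le_max_iff_disj)
  ultimately obtain t where t: "0 \<le> t" "t \<le> 1" and gt: "g t = v"
    using IVT'[of g 0 v 1] by auto
  have "finite S" using S(1) finite_subset by blast
  then obtain h where h: "bij_betw h {..<k} S"
    using S(2) by (metis atLeast0LessThan ex_bij_betw_nat_finite)
  have hS: "h c \<in> S" "h c < n" "h c \<noteq> m" if "c < k" for c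
    using h that S(1) m by (auto simp: bij_betw_def)
  have hinj: "h c = h d \<longleftrightarrow> c = d" if "c < k" "d < k" for c d
    using h that by (auto simp: bij_betw_def inj_on_def)
  obtain b where b: "b < k" "h b = l"
    using h l by (auto simp: bij_betw_def)
  define X :: "real mat" where
    "X = mat n k (\<lambda>(i, c). if i = h c then 1 else if c = b \<and> i = m then t else 0)"
  have Xe: "X $$ (i, c) = (if i = h c then 1 else if c = b \<and> i = m then t else 0)"
    if "i < n" "c < k" for i c
    using that by (simp add: X_def)
  have X: "X \<in> nonneg_mat n k"
    using t by (auto simp: nonneg_mat_def Xe) (simp add: X_def)
  have orth: "X\<^sup>T \<otimes>\<^sub>m X = 1\<^sub>m k"
  proof (rule max_orthonormal_columnsI[OF X, where h = h])
    show "X $$ (i, c) = 0 \<or> X $$ (i, d) = 0" if "i < n" "c < k" "d < k" "c \<noteq> d" for i c d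
      using that hS hinj by (auto simp: Xe)
  qed (use t hS in \<open>auto simp: Xe\<close>)
  have terms: "A $$ (l, m) * t \<le> v" "t * A $$ (m, l) \<le> v" "t * A $$ (m, m) * t \<le> v"
    using gt by (auto simp: g_def power2_eq_square mult.commute mult.left_commute)
  have "max_trace (X\<^sup>T \<otimes>\<^sub>m A \<otimes>\<^sub>m X) = v"
  proof -
    have le: "X $$ (i, c) * A $$ (i, j) * X $$ (j, c) \<le> v" if "c < k" "i < n" "j < n" for c i j
    proof (cases "c = b")
      case True
      then show ?thesis
        using that terms diag[OF l] v0 b m l by (auto simp: Xe)
    next
      case False
      then show ?thesis
        using that diag[OF hS(1)[OF that(1)]] v0 by (auto simp: Xe)
    qed
    consider "A $$ (l, l) = v" | "t * A $$ (l, m) = v" | "t * A $$ (m, l) = v" | "t * A $$ (m, m) * t = v"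
      using gt by (auto simp: g_def max_def power2_eq_square mult.commute mult.left_commute split: if_splits)
    then show ?thesis
    proof cases
      case 1
      show ?thesis
        by (rule max_trace_congruence_eqI[OF cA X le b(1) ln ln])
          (use 1 b ln in \<open>auto simp: Xe\<close>)
    next
      case 2
      show ?thesis
        by (rule max_trace_congruence_eqI[OF cA X le b(1) ln m(1)])
          (use 2 b m l hS ln in \<open>auto simp: Xe mult.commute\<close>)
    next
      case 3
      show ?thesis
        by (rule max_trace_congruence_eqI[OF cA X le b(1) m(1) ln])
          (use 3 b m l hS ln in \<open>auto simp: Xe mult.commute\<close>)
    next
      case 4
      show ?thesis
        by (rule max_trace_congruence_eqI[OF cA X le b(1) m(1) m(1)])
          (use 4 b m l hS ln in \<open>auto simp: Xe\<close>)
    qed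
  qed
  moreover have "max_trace (X\<^sup>T \<otimes>\<^sub>m A \<otimes>\<^sub>m X) \<in> max_numerical_range k A"
    unfolding max_numerical_range_def dA
    by (rule CollectI, rule exI[of _ X]) (rule conjI[OF refl conjI[OF X orth]])
  ultimately show ?thesis by simp
qed

text \<open>
  With \<open>p\<close>, \<open>q\<close> the indices of the largest entry, this is the hard half of the description of the
  numerical range for \<open>k < n\<close> as the interval from the \<open>k\<close>-th smallest diagonal entry to the
  largest entry. To deform within a column towards \<open>a\<^sub>p\<^sub>q\<close>, one needs \<open>l \<in> S\<close> and \<open>m \<notin> S\<close> with
  \<open>p\<close> and \<open>q\<close> among them; when \<open>p \<noteq> q\<close> are both in \<open>S\<close> or both outside it, one index of \<open>S\<close>
  has to be exchanged.
\<close>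

lemma max_numerical_range_contains:
  assumes A: "A \<in> nonneg_mat n n" and k: "1 \<le> k" "k < n"
    and S: "S \<subseteq> {..<n}" "card S = k" and diag: "\<And>s. s \<in> S \<Longrightarrow> A $$ (s, s) \<le> v"
    and pq: "p < n" "q < n" and v: "v \<le> A $$ (p, q)"
  shows "v \<in> max_numerical_range k A"
proof -
  have fin: "finite S" using S(1) finite_subset by blast
  obtain s where s: "s \<in> S" using S(2) k(1) by (cases "S = {}") auto
  have "S \<noteq> {..<n}" using S(2) k(2) by auto
  then obtain r where r: "r < n" "r \<notin> S" using S(1) by auto
  have attained: "v \<in> max_numerical_range k A"
    if "T \<subseteq> {..<n}" "card T = k" "\<And>s. s \<in> T \<Longrightarrow> A $$ (s, s) \<le> v"
      and "l \<in> T" "m < n" "m \<notin> T" "{p, q} \<subseteq> {l, m}" for T l m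
  proof (rule attained_by_deforming_column[OF A that(1-6)])
    show "\<exists>i\<in>{l, m}. \<exists>j\<in>{l, m}. v \<le> A $$ (i, j)"
      by (rule bexI[of _ p], rule bexI[of _ q]) (use that(7) v in auto)
  qed
  have exchange: "v \<in> max_numerical_range k A \<or>
      (insert m (S - {l}) \<subseteq> {..<n} \<and> card (insert m (S - {l})) = k \<and>
       (\<forall>s \<in> insert m (S - {l}). A $$ (s, s) \<le> v))"
    if "l \<in> S" "m < n" "m \<notin> S" for l m
  proof (cases "v \<le> A $$ (m, m)")
    case True
    then show ?thesis
      using attained_by_deforming_column[OF A S diag that] by blast
  next
    case False
    have "card (insert m (S - {l})) = Suc (card (S - {l}))"
      using fin that by simp
    then have "card (insert m (S - {l})) = k"
      using fin that S(2) by (metis card_Suc_Diff1)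
    then show ?thesis
      using False that S(1) diag by auto
  qed
  consider (same_in) "p \<in> S" "q = p" | (both_in) "p \<in> S" "q \<in> S" "p \<noteq> q"
    | (p_in) "p \<in> S" "q \<notin> S" | (q_in) "p \<notin> S" "q \<in> S"
    | (same_out) "p \<notin> S" "q = p" | (both_out) "p \<notin> S" "q \<notin> S" "p \<noteq> q"
    by blast
  then show ?thesis
  proof cases
    case same_in
    show ?thesis by (rule attained[OF S diag same_in(1) r]) (use same_in in auto)
  next
    case both_in
    (* r takes over the column of q, which frees q to join the column of p *)
    from exchange[OF both_in(2) r] show ?thesis
    proof (elim disjE)
      assume T: "insert r (S - {q}) \<subseteq> {..<n} \<and> card (insert r (S - {q})) = k \<and>
        (\<forall>s \<in> insert r (S - {q}). A $$ (s, s) \<le> v)"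
      show ?thesis
        by (rule attained[of "insert r (S - {q})" p q]) (use T both_in pq r in auto)
    qed
  next
    case p_in
    show ?thesis by (rule attained[OF S diag p_in(1) pq(2) p_in(2)]) auto
  next
    case q_in
    show ?thesis by (rule attained[OF S diag q_in(2) pq(1) q_in(1)]) auto
  next
    case same_out
    show ?thesis by (rule attained[OF S diag s pq(1) same_out(1)]) (use same_out in auto)
  next
    case both_out
    (* p takes over the column of s, and q then joins it *)
    from exchange[OF s pq(1) both_out(1)] show ?thesis
    proof (elim disjE)
      assume T: "insert p (S - {s}) \<subseteq> {..<n} \<and> card (insert p (S - {s})) = k \<and>
        (\<forall>s \<in> insert p (S - {s}). A $$ (s, s) \<le> v)"
      show ?thesis
        by (rule attained[of "insert p (S - {s})" p q]) (use T both_out pq in auto)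
    qed
  qed
qed

section \<open>Bounds for the geometric max eigenvalues\<close>

lemma max_mat_pow_dims [simp]:
  assumes "A \<in> carrier_mat n n"
  shows "dim_row (max_mat_pow A t) = n" "dim_col (max_mat_pow A t) = n"
  using assms by (induction t) (auto simp: max_mat_mult_def)

lemma max_mat_pow_entry_bounds:
  assumes A: "A \<in> nonneg_mat n n"
    and M: "\<And>i j. i < n \<Longrightarrow> j < n \<Longrightarrow> A $$ (i, j) \<le> M" and ij: "i < n" "j < n"
  shows "0 \<le> max_mat_pow A t $$ (i, j) \<and> max_mat_pow A t $$ (i, j) \<le> M ^ t"
  using ij
proof (induction t arbitrary: j)
  case 0
  then show ?case using A by (auto simp: nonneg_mat_def)
next
  case (Suc t)
  have cA: "A \<in> carrier_mat n n" and A0: "\<And>i j. i < n \<Longrightarrow> j < n \<Longrightarrow> 0 \<le> A $$ (i, j)"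
    using A by (auto simp: nonneg_mat_def)
  let ?F = "(\<lambda>l. max_mat_pow A t $$ (i, l) * A $$ (l, j)) ` {..<n}"
  have "max_mat_pow A (Suc t) $$ (i, j) = Max ?F"
    using Suc.prems cA by (simp add: max_mat_mult_def)
  also have "Max ?F \<in> ?F"
    by (rule Max_in) (use Suc.prems in auto)
  finally obtain l where l: "l < n"
    and eq: "max_mat_pow A (Suc t) $$ (i, j) = max_mat_pow A t $$ (i, l) * A $$ (l, j)"
    by auto
  have "max_mat_pow A t $$ (i, l) * A $$ (l, j) \<le> M ^ t * M"
    using Suc.IH[OF Suc.prems(1) l] A0[OF l Suc.prems(2)] M[OF l Suc.prems(2)]
    by (intro mult_mono) auto
  then show ?case
    using eq Suc.IH[OF Suc.prems(1) l] A0[OF l Suc.prems(2)] by (simp add: mult.commute)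
qed

lemma max_mat_pow_diag_ge:
  assumes A: "A \<in> nonneg_mat n n" and j: "j < n"
  shows "A $$ (j, j) ^ t \<le> max_mat_pow A t $$ (j, j)"
proof (induction t)
  case 0
  then show ?case using A j by (auto simp: nonneg_mat_def)
next
  case (Suc t)
  have cA: "A \<in> carrier_mat n n" and A0: "0 \<le> A $$ (j, j)"
    using A j by (auto simp: nonneg_mat_def)
  have "A $$ (j, j) ^ Suc t \<le> max_mat_pow A t $$ (j, j) * A $$ (j, j)"
    using mult_right_mono[OF Suc A0] by (simp add: mult.commute)
  also have "\<dots> \<le> Max ((\<lambda>l. max_mat_pow A t $$ (j, l) * A $$ (l, j)) ` {..<n})"
    by (rule Max_ge) (use j in auto)
  also have "\<dots> = max_mat_pow A (Suc t) $$ (j, j)"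
    using j cA by (simp add: max_mat_mult_def)
  finally show ?case .
qed

text \<open>
  The product with \<open>e\<^sub>j\<close> is the \<open>j\<close>-th column also in max algebra, because on a nonnegative column
  the zero terms do not raise the maximum.
\<close>

lemma max_mat_vec_unit_vec:
  assumes P: "P \<in> nonneg_mat n n" and ij: "i < n" "j < n"
  shows "(P \<otimes>\<^sub>v unit_vec n j) $ i = P $$ (i, j)"
proof -
  have "(P \<otimes>\<^sub>v unit_vec n j) $ i = Max ((\<lambda>l. P $$ (i, l) * unit_vec n j $ l) ` {..<n})"
    using P ij by (auto simp: max_mat_vec_def nonneg_mat_def)
  also have "\<dots> = P $$ (i, j)"
  proof (rule Max_eqI)
    show "y \<le> P $$ (i, j)" if "y \<in> (\<lambda>l. P $$ (i, l) * unit_vec n j $ l) ` {..<n}" for y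
      using that P ij by (auto simp: nonneg_mat_def unit_vec_def)
    show "P $$ (i, j) \<in> (\<lambda>l. P $$ (i, l) * unit_vec n j $ l) ` {..<n}"
      by (rule image_eqI[of _ _ j]) (use ij in auto)
  qed simp
  finally show ?thesis .
qed

lemma geom_max_eigenvalue_bounds:
  assumes A: "A \<in> nonneg_mat n n"
    and M: "\<And>i j. i < n \<Longrightarrow> j < n \<Longrightarrow> A $$ (i, j) \<le> M" and j: "j < n"
  shows "A $$ (j, j) \<le> geom_max_eigenvalue A j" and "geom_max_eigenvalue A j \<le> M"
proof -
  have cA: "A \<in> carrier_mat n n" and dA: "dim_row A = n" and ajj: "0 \<le> A $$ (j, j)"
    using A j by (auto simp: nonneg_mat_def)
  have M0: "0 \<le> M" using M[OF j j] ajj by simp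
  define N where "N t = max_norm_vec (max_mat_pow A t \<otimes>\<^sub>v unit_vec n j)" for t
  have N: "A $$ (j, j) ^ t \<le> N t" "N t \<le> M ^ t" for t
  proof -
    have P: "max_mat_pow A t \<in> nonneg_mat n n"
      using max_mat_pow_entry_bounds[OF A M] cA by (auto simp: nonneg_mat_def intro!: carrier_matI)
    have Neq: "N t = Max ((\<lambda>i. \<bar>max_mat_pow A t $$ (i, j)\<bar>) ` {..<n})"
      using max_mat_vec_unit_vec[OF P _ j] cA
      by (auto simp: N_def max_norm_vec_def max_mat_vec_def intro!: arg_cong[where f = Max] image_cong)
    have "A $$ (j, j) ^ t \<le> \<bar>max_mat_pow A t $$ (j, j)\<bar>"
      using max_mat_pow_diag_ge[OF A j, of t] by linarith
    also have "\<dots> \<le> N t"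
      unfolding Neq by (rule Max_ge) (use j in auto)
    finally show "A $$ (j, j) ^ t \<le> N t" .
    show "N t \<le> M ^ t"
      unfolding Neq using j max_mat_pow_entry_bounds[OF A M _ j] by (subst Max_le_iff) auto
  qed
  have root: "A $$ (j, j) \<le> root t (N t)" "root t (N t) \<le> M" if "0 < t" for t
    using real_root_le_mono[OF that N(1)[of t]] real_root_le_mono[OF that N(2)[of t]]
    by (simp_all add: real_root_power_cancel that ajj M0)
  let ?L = "limsup (\<lambda>t. ereal (root t (N t)))"
  have "ereal (A $$ (j, j)) \<le> liminf (\<lambda>t. ereal (root t (N t)))"
    by (rule Liminf_bounded) (use root in \<open>auto simp: eventually_at_top_dense\<close>)
  also have "\<dots> \<le> ?L"
    by (rule Liminf_le_Limsup) simp
  finally have lower: "ereal (A $$ (j, j)) \<le> ?L" .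
  have upper: "?L \<le> ereal M"
    by (rule Limsup_bounded) (use root in \<open>auto simp: eventually_at_top_dense\<close>)
  have "geom_max_eigenvalue A j = real_of_ereal ?L"
    by (simp add: geom_max_eigenvalue_def local_spectral_radius_def N_def dA)
  then show "A $$ (j, j) \<le> geom_max_eigenvalue A j" "geom_max_eigenvalue A j \<le> M"
    using lower upper by (cases ?L; auto)+
qed

section \<open>The max convex hull of the geometric spectrum\<close>

theorem proposition3p18:
  fixes A :: "real mat" and n k :: nat
  assumes "A \<in> nonneg_mat n n"
    and "1 \<le> k" and "k < n"
  shows "max_convex_hull (max_geom_spectrum k A) \<subseteq> max_numerical_range k A"
proof
  note A = assms(1) and k = assms(2,3)
  have dA: "dim_row A = n" and A0: "\<And>i j. i < n \<Longrightarrow> j < n \<Longrightarrow> 0 \<le> A $$ (i, j)"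
    using A by (auto simp: nonneg_mat_def)
  let ?E = "(\<lambda>(i, j). A $$ (i, j)) ` ({..<n} \<times> {..<n})"
  have "Max ?E \<in> ?E"
    by (rule Max_in) (use k in auto)
  then obtain p q where pq: "p < n" "q < n" and Mpq: "Max ?E = A $$ (p, q)"
    by auto
  have M: "A $$ (i, j) \<le> A $$ (p, q)" if "i < n" "j < n" for i j
    unfolding Mpq[symmetric] by (rule Max_ge) (use that in auto)
  note bounds = geom_max_eigenvalue_bounds[OF A M]
  fix v assume "v \<in> max_convex_hull (max_geom_spectrum k A)"
  then obtain m :: nat and \<alpha> x :: "nat \<Rightarrow> real" where
    v: "v = Max ((\<lambda>i. \<alpha> i * x i) ` {..<m})" and m: "0 < m"
    and x: "\<And>i. i < m \<Longrightarrow> x i \<in> max_geom_spectrum k A"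
    and \<alpha>0: "\<And>i. i < m \<Longrightarrow> 0 \<le> \<alpha> i" and \<alpha>1: "Max (\<alpha> ` {..<m}) = 1"
    unfolding max_convex_hull_def by blast
  have "v \<le> A $$ (p, q)"
  proof -
    have "\<alpha> i * x i \<le> A $$ (p, q)" if i: "i < m" for i
    proof -
      have "\<alpha> i \<le> 1"
        unfolding \<alpha>1[symmetric] by (rule Max_ge) (use i in auto)
      moreover have "x i \<le> A $$ (p, q)"
      proof -
        obtain f where f: "f ` {..<k} \<subseteq> {..<n}"
          and xi: "x i = Max ((\<lambda>j. geom_max_eigenvalue A (f j)) ` {..<k})"
          using x[OF i] by (auto simp: max_geom_spectrum_def dA)
        show ?thesis
          unfolding xi using k(1) bounds(2) f by (subst Max_le_iff) (auto simp: image_subset_iff lessThan_empty_iff)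
      qed
      ultimately have "\<alpha> i * x i \<le> 1 * A $$ (p, q)"
        using \<alpha>0[OF i] A0[OF pq] by (meson mult_mono' mult_left_mono mult_right_mono order_trans)
      then show ?thesis by simp
    qed
    then show ?thesis unfolding v using m by (subst Max_le_iff) auto
  qed
  moreover obtain S where "S \<subseteq> {..<n}" "card S = k" "\<And>s. s \<in> S \<Longrightarrow> A $$ (s, s) \<le> v"
  proof -
    have "Max (\<alpha> ` {..<m}) \<in> \<alpha> ` {..<m}"
      by (rule Max_in) (use m in auto)
    then obtain i where i: "i < m" "\<alpha> i = 1"
      using \<alpha>1 by auto
    have "\<alpha> i * x i \<le> v"
      unfolding v by (intro Max_ge imageI) (use i in simp_all)
    then have xv: "x i \<le> v" using i by simp
    obtain f where f: "strict_mono_on {..<k} f" "f ` {..<k} \<subseteq> {..<n}"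
      and xi: "x i = Max ((\<lambda>j. geom_max_eigenvalue A (f j)) ` {..<k})"
      using x[OF i(1)] by (auto simp: max_geom_spectrum_def dA)
    have "A $$ (s, s) \<le> v" if "s \<in> f ` {..<k}" for s
    proof -
      have "A $$ (s, s) \<le> geom_max_eigenvalue A s"
        using bounds(1) f(2) that by blast
      also have "\<dots> \<le> x i"
        unfolding xi by (rule Max_ge) (use that in auto)
      finally show ?thesis using xv by simp
    qed
    moreover have "card (f ` {..<k}) = k"
      using f(1) by (simp add: card_image strict_mono_on_imp_inj_on)
    ultimately show ?thesis using f(2) that by blast
  qed
  ultimately show "v \<in> max_numerical_range k A"
    using max_numerical_range_contains[OF A k] pq by blast
qed

end
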